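(* For every $n\ge 1$, the number of decreasing $\pm$trees on $n$ vertices is $2^{n-1}(n-1)!$.
   Context: A $\pm$tree on $n$ vertices is a tree with vertex set $[n]=\{1,\dots,n\}$, rooted at vertex $n$, with edges oriented away from the root, together with a labeling of each edge by $+$ or $-$. A decreasing $\pm$tree on $n$ vertices is a $\pm$tree such that, on any path directed away from the root: (1) along every edge labeled $-$ the vertex labels decrease (if $u\to v$ is labeled $-$ then $u>v$); (2) for $i<j$ and any $k$, there is no path $j\xrightarrow{-} i\xrightarrow{+} k$; (3) for all $i_1<i_2<i_3<i_4$ there is no subpath of any of the three forms $i_4\xrightarrow{+}i_1\xrightarrow{+}i_2\xrightarrow{+}i_3$, $i_4\xrightarrow{+}i_1\xrightarrow{+}i_3\xrightarrow{+}i_2$, $i_4\xrightarrow{+}i_2\xrightarrow{+}i_1\xrightarrow{+}i_3$, nor of their reverses (the same vertex sequences read in the opposite order, with all three edges labeled $+$). *)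

theory Defs
  imports "Graph_Theory.Graph_Theory" "HOL-Library.FuncSet"
begin

text \<open>
  A tree is represented together with its orientation away from the root, as a digraph whose
  arcs are pairs (parent, child).  That the underlying undirected graph is a tree is expressed
  on \<open>mk_symmetric G\<close>.  In a symmetric digraph the closed walk u, v, u counts as a cycle,
  so a cycle of the undirected graph is a cycle of length at least 3.  (The constant \<open>tree\<close>
  of Graph_Theory only forbids directed cycles, so it would admit e.g. an acyclically oriented
  triangle.)
\<close>

definition oriented_tree :: "'a pair_pre_digraph \<Rightarrow> bool" where
  "oriented_tree G \<longleftrightarrow>
     pair_fin_digraph G \<and> asym (parcs G) \<and> connected (with_proj G) \<and>
     \<not> (\<exists>p. pre_digraph.cycle (with_proj (mk_symmetric G)) p \<and> length p \<ge> 3)"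

text \<open>
  An arc \<open>(u, v)\<close> points away from the root \<open>r\<close> if the path of the undirected tree
  from \<open>r\<close> to \<open>v\<close> goes through \<open>u\<close>.
\<close>

definition oriented_away_from :: "'a pair_pre_digraph \<Rightarrow> 'a \<Rightarrow> bool" where
  "oriented_away_from G r \<longleftrightarrow>
     r \<in> pverts G \<and>
     (\<forall>(u, v) \<in> parcs G. \<forall>p. pre_digraph.apath (with_proj (mk_symmetric G)) r p v \<longrightarrow>
        u \<in> set (pre_digraph.awalk_verts (with_proj (mk_symmetric G)) r p))"

datatype sign = Plus | Minus

text \<open>The labeling is extensional, so that it is determined by its values on the arcs.\<close>

definition pm_tree :: "nat \<Rightarrow> nat pair_pre_digraph \<Rightarrow> (nat \<times> nat \<Rightarrow> sign) \<Rightarrow> bool" where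
  "pm_tree n G l \<longleftrightarrow>
     oriented_tree G \<and> pverts G = {1..n} \<and> oriented_away_from G n \<and>
     l \<in> parcs G \<rightarrow>\<^sub>E {Plus, Minus}"

definition signed_arc ::
  "nat pair_pre_digraph \<Rightarrow> (nat \<times> nat \<Rightarrow> sign) \<Rightarrow> sign \<Rightarrow> nat \<Rightarrow> nat \<Rightarrow> bool" where
  "signed_arc G l s u v \<longleftrightarrow> (u, v) \<in> parcs G \<and> l (u, v) = s"

definition plus_path ::
  "nat pair_pre_digraph \<Rightarrow> (nat \<times> nat \<Rightarrow> sign) \<Rightarrow> nat list \<Rightarrow> bool" where
  "plus_path G l vs \<longleftrightarrow> successively (signed_arc G l Plus) vs"

text \<open>
  Paths directed away from the root are exactly the directed paths, and subpaths are contiguous.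
\<close>

definition decreasing_pm_tree ::
  "nat \<Rightarrow> nat pair_pre_digraph \<Rightarrow> (nat \<times> nat \<Rightarrow> sign) \<Rightarrow> bool" where
  "decreasing_pm_tree n G l \<longleftrightarrow>
     pm_tree n G l \<and>
     (\<forall>u v. signed_arc G l Minus u v \<longrightarrow> u > v) \<and>
     (\<forall>i j k. i < j \<longrightarrow> \<not> (signed_arc G l Minus j i \<and> signed_arc G l Plus i k)) \<and>
     (\<forall>i1 i2 i3 i4. i1 < i2 \<and> i2 < i3 \<and> i3 < i4 \<longrightarrow>
        (\<forall>vs \<in> {[i4, i1, i2, i3], [i4, i1, i3, i2], [i4, i2, i1, i3]}.
           \<not> plus_path G l vs \<and> \<not> plus_path G l (rev vs)))"

end

theory Submission
  imports Defs
begin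

text \<open>
  On a path from the root, the six forbidden patterns together say exactly that every plus vertex
  is smaller than its grandparent.  So a decreasing \<open>\<plusminus>\<close>tree is a parent map
  \<open>f\<close> with a set \<open>P\<close> of plus vertices such that minus vertices satisfy
  \<open>v < f v\<close>, and plus vertices have the root or a plus vertex as parent and satisfy
  \<open>v < f (f v)\<close> if they are not children of the root; acyclicity is then automatic.

  Let \<open>D\<close> count these over a set \<open>U\<close> of non-root vertices.  Adding a new minimum
  \<open>m\<close> multiplies \<open>D\<close> by \<open>2 (card U + 1)\<close>: as a minus vertex \<open>m\<close> is a leaf
  with \<open>card U + 1\<close> possible parents.  As a plus vertex it has no grandchildren, so deleting
  it together with its set \<open>C\<close> of plus children leaves a valid plus tree on some \<open>S\<close>, and for
  each \<open>S\<close> the total weight of the pairs of \<open>C\<close> and a parent \<open>p > max C\<close> is again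
  \<open>card U + 1\<close> times the weight of \<open>S\<close>.
\<close>

section \<open>Maps increasing along grandparents\<close>

text \<open>These maps describe the plus part of a tree, with \<open>r\<close> meant to lie outside
  \<open>A\<close>. The disjunct \<open>g v = r\<close> exempts the children of the root, which have
  no grandparent.\<close>

definition gp_maps :: "'a::linorder \<Rightarrow> 'a set \<Rightarrow> ('a \<Rightarrow> 'a) set" where
  "gp_maps r A = {g \<in> A \<rightarrow>\<^sub>E insert r A. \<forall>v\<in>A. g v = r \<or> v < g (g v)}"

lemma finite_gp_maps: "finite A \<Longrightarrow> finite (gp_maps r A)"
  unfolding gp_maps_def by (rule finite_subset[OF _ finite_PiE[of A "\<lambda>_. insert r A"]]) auto

lemma sum_Pow_insert:
  assumes "finite A" "x \<notin> A"
  shows "(\<Sum>B\<in>Pow (insert x A). f B) = (\<Sum>B\<in>Pow A. f B + f (insert x B))"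
proof -
  have inj: "inj_on (insert x) (Pow A)" using assms(2) by (auto simp: inj_on_def)
  have "(\<Sum>B\<in>Pow (insert x A). f B) = sum f (Pow A) + sum f (insert x ` Pow A)"
    unfolding Pow_insert using assms by (intro sum.union_disjoint) auto
  then show ?thesis by (simp add: sum.reindex[OF inj] sum.distrib)
qed

text \<open>Nothing lies below \<open>m\<close>, so \<open>m\<close> is nobody's grandparent and its
  children \<open>C\<close> are leaves. A map is therefore given by \<open>C\<close>, its
  restriction to \<open>A - C\<close> and the parent \<open>p\<close> of \<open>m\<close>. The
  condition at \<open>c \<in> C\<close> becomes \<open>c < p\<close>, while the condition at
  \<open>m\<close> holds by minimality.\<close>

lemma card_gp_maps_insert:
  assumes fin: "finite A" and m: "\<forall>a\<in>insert r A. m < a" and r: "r \<notin> A"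
  shows "card (gp_maps r (insert m A)) =
    (\<Sum>C\<in>Pow A. card (gp_maps r (A - C)) * card {p \<in> insert r (A - C). \<forall>c\<in>C. c < p})"
proof -
  let ?R = "SIGMA C:Pow A. gp_maps r (A - C) \<times> {p \<in> insert r (A - C). \<forall>c\<in>C. c < p}"
  let ?F = "\<lambda>g. ({c \<in> A. g c = m}, restrict g (A - {c \<in> A. g c = m}), g m)"
  let ?B = "\<lambda>(C, h, p) v. if v = m then p else if v \<in> C then m else h v"
  have mr: "m \<noteq> r" "m \<notin> A" using m by auto
  have "bij_betw ?F (gp_maps r (insert m A)) ?R"
  proof (rule bij_betw_byWitness[where f' = ?B])
    show "\<forall>g\<in>gp_maps r (insert m A). ?B (?F g) = g"
      using mr by (auto simp: gp_maps_def PiE_def extensional_def restrict_def fun_eq_iff)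
    show "\<forall>x\<in>?R. ?F (?B x) = x"
    proof
      fix x assume "x \<in> ?R"
      then obtain C h p where x: "x = (C, h, p)" and C: "C \<subseteq> A" and h: "h \<in> gp_maps r (A - C)"
        and p: "p \<in> insert r (A - C)" by auto
      have hm: "h v \<noteq> m" if "v \<in> A - C" for v
        using h that mr by (auto simp: gp_maps_def PiE_def Pi_def)
      have 1: "{c \<in> A. ?B x c = m} = C"
        using C hm mr x by auto
      have 2: "restrict (?B x) (A - C) = h"
        using h mr x
        by (auto simp: gp_maps_def PiE_def extensional_def restrict_def fun_eq_iff)
      show "?F (?B x) = x" unfolding 1 2 by (simp add: x)
    qed
    show "?F ` gp_maps r (insert m A) \<subseteq> ?R"
    proof (rule image_subsetI)
      fix g assume g: "g \<in> gp_maps r (insert m A)"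
      define C where "C = {c \<in> A. g c = m}"
      have gv: "g v \<in> insert r (insert m A)" "g v = r \<or> v < g (g v)" if "v \<in> insert m A" for v
        using g that by (auto simp: gp_maps_def)
      \<comment> \<open>If \<open>g v\<close> were a child of \<open>m\<close>, then
        \<open>m\<close> would be the grandparent of \<open>v\<close>, forcing
        \<open>v < m\<close>.\<close>
      have gC: "g v \<notin> C" if v: "v \<in> insert m A" for v
        using gv[OF v] v m r by (auto simp: C_def)
      have gm: "g m \<noteq> m" using gv[of m] mr by auto
      have "restrict g (A - C) \<in> gp_maps r (A - C)"
      proof -
        have "g v \<in> insert r (A - C)" if "v \<in> A - C" for v
          using gv[of v] gC[of v] that by (auto simp: C_def)
        then show ?thesis using gv by (auto simp: gp_maps_def)
      qed
      moreover have "c < g m" if "c \<in> C" for c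
        using gv[of c] that mr by (auto simp: C_def)
      moreover have "g m \<in> insert r (A - C)"
        using gv[of m] gC[of m] gm by auto
      ultimately show "?F g \<in> ?R" by (auto simp flip: C_def) (auto simp: C_def)
    qed
    show "?B ` ?R \<subseteq> gp_maps r (insert m A)"
    proof (rule image_subsetI)
      fix x assume "x \<in> ?R"
      then obtain C h p where x: "x = (C, h, p)" and C: "C \<subseteq> A" and h: "h \<in> gp_maps r (A - C)"
        and p: "p \<in> insert r (A - C)" "\<forall>c\<in>C. c < p" by auto
      have pm: "p \<noteq> m" "p \<notin> C" using p mr r C by auto
      have hv: "h v \<in> insert r (A - C)" "h v = r \<or> v < h (h v)" if "v \<in> A - C" for v
        using h that by (auto simp: gp_maps_def)
      have hu: "h v = undefined" if "v \<notin> A - C" for v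
        using h that by (auto simp: gp_maps_def)
      have "?B (C, h, p) v = r \<or> v < ?B (C, h, p) (?B (C, h, p) v)" if v: "v \<in> insert m A" for v
      proof -
        consider "v = m" | "v \<in> C" | "v \<in> A - C" using v by auto
        then show ?thesis
        proof cases
          case 1
          then show ?thesis using p(1) pm hv[of p] m by auto
        next
          case 2
          then show ?thesis using p C mr by auto
        next
          case 3
          then show ?thesis using hv[OF 3] mr C by auto
        qed
      qed
      moreover have "?B (C, h, p) \<in> insert m A \<rightarrow>\<^sub>E insert r (insert m A)"
        using hv(1) hu p C by (auto simp: PiE_iff extensional_def)
      ultimately show "?B x \<in> gp_maps r (insert m A)"
        unfolding x gp_maps_def by blast
    qed
  qed
  then have "card (gp_maps r (insert m A)) = card ?R" by (rule bij_betw_same_card)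
  also have "\<dots> = (\<Sum>C\<in>Pow A. card (gp_maps r (A - C)) * card {p \<in> insert r (A - C). \<forall>c\<in>C. c < p})"
    using fin by (subst card_SigmaI) (auto simp: finite_gp_maps card_cartesian_product)
  finally show ?thesis .
qed

section \<open>Weighted sums over sets of plus vertices\<close>

text \<open>Induction over \<open>U\<close> from above: adding a new minimum \<open>m\<close> to \<open>S\<close> contributes the set
  \<open>C = {}\<close> with \<open>p = m\<close>; adding it outside \<open>S\<close> contributes the factor \<open>w m + 1\<close>, since
  \<open>m \<in> C\<close> puts no constraint on \<open>p\<close>.\<close>

lemma sum_subsets_below:
  fixes w :: "'a::linorder \<Rightarrow> nat"
  assumes "finite U" "\<forall>u\<in>U. u < r" "S \<subseteq> U" "\<forall>v\<in>U. w v = card {u \<in> insert r U. v < u}"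
  shows "(\<Sum>C\<in>Pow (U - S). card {p \<in> insert r S. \<forall>c\<in>C. c < p} * (\<Prod>v\<in>U - S - C. w v))
    = (card U + 1) * (\<Prod>v\<in>U - S. w v)"
  using assms
proof (induction U arbitrary: S rule: finite_linorder_min_induct)
  case empty
  then show ?case by simp
next
  case (insert m U)
  have mU: "m \<notin> U" using insert by auto
  have w: "\<forall>v\<in>U. w v = card {u \<in> insert r U. v < u}"
  proof
    fix v assume v: "v \<in> U"
    then have "{u \<in> insert r (insert m U). v < u} = {u \<in> insert r U. v < u}"
      using insert.hyps by auto
    then show "w v = card {u \<in> insert r U. v < u}" using insert.prems v by auto
  qed
  have wm: "w m = card U + 1"
  proof -
    have "{u \<in> insert r (insert m U). m < u} = insert r U"
      using insert by auto
    moreover have "r \<notin> U" using insert.prems by auto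
    ultimately show ?thesis using insert by auto
  qed
  show ?case
  proof (cases "m \<in> S")
    case True
    define S' where "S' = S - {m}"
    have S': "S = insert m S'" "S' \<subseteq> U" "m \<notin> S'" using True insert.prems S'_def by auto
    have U: "insert m U - S = U - S'" using S' mU by auto
    \<comment> \<open>As \<open>m\<close> lies below every \<open>c \<in> C\<close>, the extra
      choice \<open>p = m\<close> is available only for empty \<open>C\<close>.\<close>
    have card: "card {p \<in> insert r S. \<forall>c\<in>C. c < p} =
        card {p \<in> insert r S'. \<forall>c\<in>C. c < p} + (if C = {} then 1 else 0)"
      if "C \<subseteq> U - S'" for C
    proof (cases "C = {}")
      case True
      have "finite S'" "m \<noteq> r" using S' insert finite_subset by auto
      then have "card (insert m (insert r S')) = Suc (card (insert r S'))"
        using S' by (intro card_insert_disjoint) auto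
      moreover have "{p \<in> insert r S. \<forall>c\<in>C. c < p} = insert m (insert r S')"
        "{p \<in> insert r S'. \<forall>c\<in>C. c < p} = insert r S'" using True S' by auto
      ultimately show ?thesis using True by simp
    next
      case False
      then obtain c where "c \<in> C" by auto
      then have "m < c" using that insert.hyps by auto
      then have "{p \<in> insert r S. \<forall>c\<in>C. c < p} = {p \<in> insert r S'. \<forall>c\<in>C. c < p}"
        using S' \<open>c \<in> C\<close> by auto
      then show ?thesis using False by simp
    qed
    have "(\<Sum>C\<in>Pow (insert m U - S). card {p \<in> insert r S. \<forall>c\<in>C. c < p} * (\<Prod>v\<in>insert m U - S - C. w v))
      = (\<Sum>C\<in>Pow (U - S'). card {p \<in> insert r S'. \<forall>c\<in>C. c < p} * (\<Prod>v\<in>U - S' - C. w v)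
          + (if C = {} then \<Prod>v\<in>U - S'. w v else 0))"
      unfolding U
    proof (rule sum.cong[OF refl])
      fix C assume "C \<in> Pow (U - S')"
      then have "card {p \<in> insert r S. \<forall>c\<in>C. c < p} =
          card {p \<in> insert r S'. \<forall>c\<in>C. c < p} + (if C = {} then 1 else 0)" by (intro card) auto
      then show "card {p \<in> insert r S. \<forall>c\<in>C. c < p} * (\<Prod>v\<in>U - S' - C. w v) =
          card {p \<in> insert r S'. \<forall>c\<in>C. c < p} * (\<Prod>v\<in>U - S' - C. w v) +
          (if C = {} then \<Prod>v\<in>U - S'. w v else 0)"
        by (simp only: add_mult_distrib) simp
    qed
    also have "\<dots> = (card U + 1) * (\<Prod>v\<in>U - S'. w v) + (\<Prod>v\<in>U - S'. w v)"
    proof -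
      have "(\<Sum>C\<in>Pow (U - S'). card {p \<in> insert r S'. \<forall>c\<in>C. c < p} * (\<Prod>v\<in>U - S' - C. w v))
          = (card U + 1) * (\<Prod>v\<in>U - S'. w v)"
        using insert.IH[OF _ S'(2) w] insert.prems by simp
      then show ?thesis
        using insert.hyps by (simp only: sum.distrib) (simp add: sum.delta)
    qed
    also have "\<dots> = (card (insert m U) + 1) * (\<Prod>v\<in>insert m U - S. w v)"
      unfolding U using mU insert.hyps by simp
    finally show ?thesis .
  next
    case False
    then have S: "S \<subseteq> U" and U: "insert m U - S = insert m (U - S)" using insert.prems by auto
    have fU: "finite (U - S)" "m \<notin> U - S" using insert.hyps mU by auto
    have 1: "{p \<in> insert r S. \<forall>c\<in>insert m C. c < p} = {p \<in> insert r S. \<forall>c\<in>C. c < p}" for C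
      using S insert by auto
    have 2: "(\<Prod>v\<in>insert m (U - S) - C. w v) = w m * (\<Prod>v\<in>U - S - C. w v)" if "C \<subseteq> U - S" for C
    proof -
      have "insert m (U - S) - C = insert m (U - S - C)" using that mU by auto
      then show ?thesis using fU by simp
    qed
    have 3: "insert m (U - S) - insert m C = U - S - C" for C using mU by auto
    \<comment> \<open>Each \<open>C \<subseteq> U - S\<close> occurs twice: without
      \<open>m\<close>, where the product gains the factor \<open>w m\<close>, and with
      \<open>m\<close>, where nothing changes.\<close>
    have "(\<Sum>C\<in>Pow (insert m U - S). card {p \<in> insert r S. \<forall>c\<in>C. c < p} * (\<Prod>v\<in>insert m U - S - C. w v))
      = (\<Sum>C\<in>Pow (U - S). (w m + 1) *
           (card {p \<in> insert r S. \<forall>c\<in>C. c < p} * (\<Prod>v\<in>U - S - C. w v)))"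
      unfolding U sum_Pow_insert[OF fU] 1 3 by (rule sum.cong) (auto simp: 2 algebra_simps)
    also have "\<dots> = (w m + 1) * ((card U + 1) * (\<Prod>v\<in>U - S. w v))"
    proof -
      have "(\<Sum>C\<in>Pow (U - S). card {p \<in> insert r S. \<forall>c\<in>C. c < p} * (\<Prod>v\<in>U - S - C. w v))
          = (card U + 1) * (\<Prod>v\<in>U - S. w v)"
        using insert.IH[OF _ S w] insert.prems by simp
      then show ?thesis by (simp only: flip: sum_distrib_left)
    qed
    \<comment> \<open>Since \<open>w m = card U + 1\<close>, the two factors exchange roles:
      \<open>w m + 1\<close> is the new leading factor and \<open>card U + 1\<close> joins the
      product as \<open>w m\<close>.\<close>
    also have "\<dots> = (card (insert m U) + 1) * (\<Prod>v\<in>insert m U - S. w v)"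
      unfolding U using fU mU insert.hyps by (simp add: wm)
    finally show ?thesis .
  qed
qed

text \<open>The product counts the free choices of a larger parent for the vertices outside
  \<open>A\<close>. A new minimum \<open>m\<close> leaves the weights of the old vertices unchanged;
  the subsets without \<open>m\<close> and those with \<open>m\<close> each contribute
  \<open>card U + 1\<close> times the old total.\<close>

lemma weighted_gp_maps_count:
  fixes U :: "'a::linorder set"
  assumes "finite U" "\<forall>u\<in>U. u < r"
  shows "(\<Sum>A\<in>Pow U. card (gp_maps r A) * (\<Prod>v\<in>U - A. card {u \<in> insert r U. v < u}))
    = 2 ^ card U * fact (card U)"
  using assms
proof (induction U rule: finite_linorder_min_induct)
  case empty
  have "gp_maps r {} = {\<lambda>_. undefined}" by (auto simp: gp_maps_def)
  then show ?case by simp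
next
  case (insert m U)
  define w where "w v = card {u \<in> insert r (insert m U). v < u}" for v
  define D where "D = (\<Sum>A\<in>Pow U. card (gp_maps r A) * (\<Prod>v\<in>U - A. w v))"
  have mU: "m \<notin> U" "r \<notin> U" using insert by auto
  have w: "w v = card {u \<in> insert r U. v < u}" if v: "v \<in> U" for v
  proof -
    have "{u \<in> insert r (insert m U). v < u} = {u \<in> insert r U. v < u}"
      using insert.hyps v by auto
    then show ?thesis by (simp add: w_def)
  qed
  have wm: "w m = card U + 1"
  proof -
    have "{u \<in> insert r (insert m U). m < u} = insert r U"
      using insert by auto
    then show ?thesis using insert mU by (simp add: w_def)
  qed
  have D: "D = 2 ^ card U * fact (card U)"
  proof -
    have "D = (\<Sum>A\<in>Pow U. card (gp_maps r A) * (\<Prod>v\<in>U - A. card {u \<in> insert r U. v < u}))"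
      unfolding D_def by (intro sum.cong arg_cong2[where f = "(*)"] prod.cong refl) (simp add: w)
    then show ?thesis using insert by simp
  qed
  have "(\<Sum>A\<in>Pow U. card (gp_maps r A) * (\<Prod>v\<in>insert m U - A. w v)) =
      (\<Sum>A\<in>Pow U. (card U + 1) * (card (gp_maps r A) * (\<Prod>v\<in>U - A. w v)))"
  proof (rule sum.cong[OF refl])
    fix A assume "A \<in> Pow U"
    then have "insert m U - A = insert m (U - A)" using mU by auto
    then show "card (gp_maps r A) * (\<Prod>v\<in>insert m U - A. w v) =
      (card U + 1) * (card (gp_maps r A) * (\<Prod>v\<in>U - A. w v))"
      using mU insert.hyps by (simp add: wm algebra_simps)
  qed
  then have minus: "(\<Sum>A\<in>Pow U. card (gp_maps r A) * (\<Prod>v\<in>insert m U - A. w v)) = (card U + 1) * D"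
    by (simp only: D_def sum_distrib_left)
  have "(\<Sum>A\<in>Pow U. card (gp_maps r (insert m A)) * (\<Prod>v\<in>U - A. w v)) =
      (\<Sum>A\<in>Pow U. \<Sum>C\<in>Pow A. card (gp_maps r (A - C)) *
        (card {p \<in> insert r (A - C). \<forall>c\<in>C. c < p} * (\<Prod>v\<in>U - (A - C) - C. w v)))"
  proof (rule sum.cong[OF refl])
    fix A assume A: "A \<in> Pow U"
    \<comment> \<open>Written this way, the summand depends on \<open>A\<close> only through
      \<open>S = A - C\<close>, which prepares the regrouping by \<open>S\<close>.\<close>
    have *: "U - (A - C) - C = U - A" if "C \<in> Pow A" for C using that A by auto
    have "finite A" "\<forall>a\<in>insert r A. m < a" "r \<notin> A" using A insert finite_subset mU by auto
    then show "card (gp_maps r (insert m A)) * (\<Prod>v\<in>U - A. w v) = (\<Sum>C\<in>Pow A. card (gp_maps r (A - C)) *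
        (card {p \<in> insert r (A - C). \<forall>c\<in>C. c < p} * (\<Prod>v\<in>U - (A - C) - C. w v)))"
      unfolding card_gp_maps_insert[OF \<open>finite A\<close> \<open>\<forall>a\<in>insert r A. m < a\<close> \<open>r \<notin> A\<close>] sum_distrib_right mult.assoc
      by (intro sum.cong refl) (simp only: *)
  qed
  \<comment> \<open>Pairs \<open>C \<subseteq> A \<subseteq> U\<close> correspond to disjoint pairs
    \<open>S\<close>, \<open>C\<close> in \<open>U\<close> through
    \<open>A = S \<union> C\<close>.\<close>
  also have "\<dots> = (\<Sum>S\<in>Pow U. \<Sum>C\<in>Pow (U - S). card (gp_maps r S) *
        (card {p \<in> insert r S. \<forall>c\<in>C. c < p} * (\<Prod>v\<in>U - S - C. w v)))"
  proof -
    have f: "finite (Pow U)" "\<forall>A\<in>Pow U. finite (Pow A)" "\<forall>A\<in>Pow U. finite (Pow (U - A))"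
      using insert.hyps finite_subset by auto
    show ?thesis
      unfolding sum.Sigma[OF f(1,2)] sum.Sigma[OF f(1,3)]
      by (rule sum.reindex_bij_witness[where j = "\<lambda>(A, C). (A - C, C)" and i = "\<lambda>(S, C). (S \<union> C, C)"])
        auto
  qed
  also have "\<dots> = (\<Sum>S\<in>Pow U. card (gp_maps r S) * ((card U + 1) * (\<Prod>v\<in>U - S. w v)))"
  proof (rule sum.cong[OF refl])
    fix S assume "S \<in> Pow U"
    then have "(\<Sum>C\<in>Pow (U - S). card {p \<in> insert r S. \<forall>c\<in>C. c < p} * (\<Prod>v\<in>U - S - C. w v))
        = (card U + 1) * (\<Prod>v\<in>U - S. w v)"
      using insert.hyps insert.prems w by (intro sum_subsets_below) auto
    then show "(\<Sum>C\<in>Pow (U - S). card (gp_maps r S) *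
        (card {p \<in> insert r S. \<forall>c\<in>C. c < p} * (\<Prod>v\<in>U - S - C. w v))) =
        card (gp_maps r S) * ((card U + 1) * (\<Prod>v\<in>U - S. w v))"
      by (simp only: flip: sum_distrib_left)
  qed
  also have "\<dots> = (card U + 1) * D"
    unfolding D_def sum_distrib_left by (simp add: algebra_simps)
  finally have plus: "(\<Sum>A\<in>Pow U. card (gp_maps r (insert m A)) * (\<Prod>v\<in>U - A. w v)) = (card U + 1) * D" .
  have ins: "insert m U - insert m A = U - A" for A using mU by auto
  have "(\<Sum>A\<in>Pow (insert m U). card (gp_maps r A) * (\<Prod>v\<in>insert m U - A. w v)) = 2 * (card U + 1) * D"
    using minus plus by (simp add: sum_Pow_insert[OF insert.hyps(1) mU(1)] sum.distrib ins)
  also have "\<dots> = 2 ^ card (insert m U) * fact (card (insert m U))"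
    using insert.hyps mU by (simp add: D algebra_simps)
  finally show ?case unfolding w_def .
qed

section \<open>Parent maps with a set of plus vertices\<close>

text \<open>The minus condition says that minus edges decrease. Given this,
  \<open>f v = r \<or> f v \<in> P\<close> says that no plus edge follows a minus edge, and
  \<open>v < f (f v)\<close> replaces the six forbidden patterns.\<close>

definition parent_maps :: "'a::linorder \<Rightarrow> 'a set \<Rightarrow> 'a set \<Rightarrow> ('a \<Rightarrow> 'a) set" where
  "parent_maps r U P = {f \<in> U \<rightarrow>\<^sub>E insert r U.
     (\<forall>v\<in>U - P. v < f v) \<and> (\<forall>v\<in>P. f v = r \<or> f v \<in> P \<and> v < f (f v))}"

text \<open>A plus vertex has the root or a plus vertex as parent, so the conditions on
  \<open>P\<close> involve only \<open>f\<close> on \<open>P\<close>. The restrictions to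
  \<open>P\<close> and to \<open>U - P\<close> are thus independent, and on \<open>U - P\<close>
  each vertex picks any larger parent.\<close>

lemma card_parent_maps:
  assumes "finite U" "P \<subseteq> U"
  shows "card (parent_maps r U P) =
    card (gp_maps r P) * (\<Prod>v\<in>U - P. card {u \<in> insert r U. v < u})"
proof -
  let ?R = "gp_maps r P \<times> (\<Pi>\<^sub>E v\<in>U - P. {u \<in> insert r U. v < u})"
  let ?F = "\<lambda>f. (restrict f P, restrict f (U - P))"
  let ?B = "\<lambda>(g, h) v. if v \<in> P then g v else h v"
  have "bij_betw ?F (parent_maps r U P) ?R"
  proof (rule bij_betw_byWitness[where f' = ?B])
    show "\<forall>f\<in>parent_maps r U P. ?B (?F f) = f"
      by (auto simp: parent_maps_def PiE_def extensional_def fun_eq_iff)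
    show "\<forall>x\<in>?R. ?F (?B x) = x"
      by (auto simp: gp_maps_def PiE_def extensional_def fun_eq_iff restrict_def)
    show "?F ` parent_maps r U P \<subseteq> ?R"
    proof (rule image_subsetI)
      fix f assume f: "f \<in> parent_maps r U P"
      then have "restrict f P \<in> gp_maps r P"
        using assms(2) unfolding parent_maps_def gp_maps_def by fastforce
      moreover have "restrict f (U - P) \<in> (\<Pi>\<^sub>E v\<in>U - P. {u \<in> insert r U. v < u})"
        using f unfolding parent_maps_def by auto
      ultimately show "?F f \<in> ?R" by simp
    qed
    show "?B ` ?R \<subseteq> parent_maps r U P"
    proof (rule image_subsetI)
      fix x assume "x \<in> ?R"
      then obtain g h where x: "x = (g, h)" and g: "g \<in> gp_maps r P"
        and h: "h \<in> (\<Pi>\<^sub>E v\<in>U - P. {u \<in> insert r U. v < u})" by auto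
      have gv: "g v \<in> insert r P" "g v = r \<or> v < g (g v)" if "v \<in> P" for v
        using g that by (auto simp: gp_maps_def)
      have hv: "h v \<in> insert r U" "v < h v" if "v \<in> U - P" for v
        using PiE_mem[OF h that] by auto
      have hu: "h v = undefined" if "v \<notin> U" for v
        using PiE_arb[OF h] that by auto
      have "?B x \<in> U \<rightarrow>\<^sub>E insert r U"
      proof (rule PiE_I)
        fix v assume "v \<in> U"
        then show "?B x v \<in> insert r U" using gv(1)[of v] hv(1)[of v] assms(2) x by auto
      qed (use hu assms(2) x in auto)
      moreover have "\<forall>v\<in>U - P. v < ?B x v" using hv x by auto
      moreover have "?B x v = r \<or> ?B x v \<in> P \<and> v < ?B x (?B x v)" if "v \<in> P" for v
        using gv[OF that] that x by auto
      ultimately show "?B x \<in> parent_maps r U P" unfolding parent_maps_def by blast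
    qed
  qed
  then have "card (parent_maps r U P) = card ?R" by (rule bij_betw_same_card)
  then show ?thesis using assms(1) by (simp add: card_cartesian_product card_PiE)
qed

lemma card_signed_parent_maps:
  assumes "finite U" "\<forall>u\<in>U. u < r"
  shows "card (SIGMA P:Pow U. parent_maps r U P) = 2 ^ card U * fact (card U)"
proof -
  have "finite (parent_maps r U P)" for P
    by (rule finite_subset[OF _ finite_PiE[of U "\<lambda>_. insert r U"]])
      (use assms in \<open>auto simp: parent_maps_def\<close>)
  then have "card (SIGMA P:Pow U. parent_maps r U P) = (\<Sum>P\<in>Pow U. card (parent_maps r U P))"
    using assms(1) by (intro card_SigmaI) auto
  also have "\<dots> = (\<Sum>P\<in>Pow U. card (gp_maps r P) * (\<Prod>v\<in>U - P. card {u \<in> insert r U. v < u}))"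
    using assms(1) by (intro sum.cong refl card_parent_maps) auto
  finally show ?thesis using weighted_gp_maps_count[OF assms] by simp
qed

section \<open>Arborescences\<close>

lemma pcas_nth: "pcas u p v \<Longrightarrow> Suc i < length p \<Longrightarrow> fst (p ! Suc i) = snd (p ! i)"
proof (induction p arbitrary: u i)
  case (Cons e p)
  then show ?case by (cases i; cases p) auto
qed simp

text \<open>The directed description of a rooted tree, which mediates between the undirected
  definition and parent maps.\<close>

definition arborescence_from :: "'a pair_pre_digraph \<Rightarrow> 'a \<Rightarrow> bool" where
  "arborescence_from G r \<longleftrightarrow> pair_fin_digraph G \<and> r \<in> pverts G \<and>
     (\<forall>v\<in>pverts G. (r, v) \<in> (parcs G)\<^sup>*) \<and>
     (\<forall>u u' v. (u, v) \<in> parcs G \<longrightarrow> (u', v) \<in> parcs G \<longrightarrow> u = u') \<and>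
     (\<forall>u. (u, r) \<notin> parcs G)"

lemma arborescence_fromD:
  assumes "arborescence_from G r"
  shows "pair_fin_digraph G" "r \<in> pverts G" "v \<in> pverts G \<Longrightarrow> (r, v) \<in> (parcs G)\<^sup>*"
    "(u, v) \<in> parcs G \<Longrightarrow> (u', v) \<in> parcs G \<Longrightarrow> u = u'" "(u, r) \<notin> parcs G"
  using assms by (auto simp: arborescence_from_def)

text \<open>A directed cycle through \<open>v\<close> also passes through the unique parent of
  \<open>v\<close>. Moving up step by step, it would reach the root, which no arc enters.\<close>

lemma acyclic_arborescence:
  assumes "arborescence_from G r"
  shows "acyclic (parcs G)"
proof (rule acyclicI, intro allI)
  note G = arborescence_fromD[OF assms]
  interpret pair_fin_digraph G by (rule G)
  fix x show "(x, x) \<notin> (parcs G)\<^sup>+"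
  proof (cases "x \<in> pverts G")
    case True
    from G(3)[OF this] show ?thesis
    proof (induction rule: rtrancl_induct)
      case base
      then show ?case using G(5) by (auto elim: tranclE)
    next
      case (step u v)
      show ?case
      proof
        assume "(v, v) \<in> (parcs G)\<^sup>+"
        then obtain u' where "(v, u') \<in> (parcs G)\<^sup>*" "(u', v) \<in> parcs G"
          by (meson tranclD2)
        with step.hyps G(4) have "(u, u) \<in> (parcs G)\<^sup>+"
          by (metis rtrancl_into_trancl2)
        with step.IH show False by simp
      qed
    qed
  next
    case False
    then show ?thesis by (meson in_arcsD1 tranclD)
  qed
qed

lemma parcs_mk_symmetric_iff:
  "(u, v) \<in> parcs (mk_symmetric (with_proj G)) \<longleftrightarrow> (u, v) \<in> parcs G \<or> (v, u) \<in> parcs G"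
  by (simp add: parcs_mk_symmetric) (metis fst_conv snd_conv prod.collapse)

section \<open>Undirected cycles and walks in an arborescence\<close>

text \<open>On an undirected cycle, a vertex without children on the cycle has both of its neighbours
  as parents.\<close>

lemma no_cycle_arborescence:
  assumes "arborescence_from G r" "pre_digraph.cycle (with_proj (mk_symmetric (with_proj G))) p"
  shows "length p < 3"
proof (rule ccontr)
  assume "\<not> length p < 3"
  then have k: "length p \<ge> 3" by simp
  note G = arborescence_fromD[OF assms(1)]
  interpret pair_fin_digraph G by (rule G)
  let ?S = "mk_symmetric (with_proj G)"
  interpret S: pair_wf_digraph ?S by (rule wellformed_mk_symmetric)
  obtain u where u: "S.awalk u p u" "distinct (tl (pawalk_verts u p))" "p \<noteq> []"
    using assms(2) unfolding S.cycle_def by auto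
  have cas: "pcas u p u" and arcs: "set p \<subseteq> parcs ?S"
    using u(1) by (auto simp: S.awalk_def)
  have verts: "tl (pawalk_verts u p) = map snd p"
    using S.awalk_verts_conv'[of u p u] cas u(3) by simp
  let ?k = "length p"
  \<comment> \<open>Positions on the cycle are read cyclically: the arc \<open>p ! nxt i\<close>
    leaves the vertex that \<open>p ! i\<close> enters.\<close>
  define nxt where "nxt i = (if Suc i < ?k then Suc i else 0)" for i
  define prv where "prv i = (if i = 0 then ?k - 1 else i - 1)" for i
  have hd: "fst (p ! 0) = snd (p ! (?k - 1))"
  proof -
    have "fst (p ! 0) = u" using cas u(3) by (cases p) auto
    moreover have "snd (last p) = u"
      using S.awlast_if_cas[OF cas] u(3) by (simp add: S.awalk_verts_conv)
    ultimately show ?thesis using u(3) by (simp add: last_conv_nth)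
  qed
  have n: "nxt i < ?k" "fst (p ! nxt i) = snd (p ! i)" if "i < ?k" for i
  proof -
    show "nxt i < ?k" using k by (auto simp: nxt_def)
    show "fst (p ! nxt i) = snd (p ! i)"
    proof (cases "Suc i < ?k")
      case True
      then show ?thesis using pcas_nth[OF cas] by (simp add: nxt_def)
    next
      case False
      then have "i = ?k - 1" using that by simp
      then show ?thesis using hd False by (simp add: nxt_def)
    qed
  qed
  have np: "prv i < ?k" "nxt (prv i) = i" if "i < ?k" for i
    using that k by (auto simp: nxt_def prv_def)
  \<comment> \<open>Finiteness and acyclicity yield a vertex \<open>x\<close> of the cycle that has
    no child on it.\<close>
  have "wf ((parcs G)\<inverse>)"
    using acyclic_arborescence[OF assms(1)] pair_finite_arcs by (rule finite_acyclic_wf_converse[rotated])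
  moreover have "snd (p ! 0) \<in> set (map snd p)" using u(3) by simp
  ultimately obtain x where x: "x \<in> set (map snd p)"
    "\<And>y. (y, x) \<in> (parcs G)\<inverse> \<Longrightarrow> y \<notin> set (map snd p)"
    by (rule wfE_min) blast
  obtain i where i: "i < ?k" "x = snd (p ! i)" using x(1) by (auto simp: in_set_conv_nth)
  have "p ! i \<in> parcs ?S" "p ! nxt i \<in> parcs ?S" using arcs i n by auto
  moreover have "fst (p ! i) = snd (p ! prv i)" using n(2)[OF np(1)[OF i(1)]] np(2)[OF i(1)] by simp
  ultimately have "(snd (p ! prv i), x) \<in> parcs ?S" "(x, snd (p ! nxt i)) \<in> parcs ?S"
    using n(2)[OF i(1)] i(2) by (metis prod.collapse)+
  moreover have "snd (p ! prv i) \<in> set (map snd p)" "snd (p ! nxt i) \<in> set (map snd p)"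
    using n np i by auto
  ultimately have "(snd (p ! prv i), x) \<in> parcs G" "(snd (p ! nxt i), x) \<in> parcs G"
    using x(2) by (auto simp: parcs_mk_symmetric_iff)
  then have "snd (p ! prv i) = snd (p ! nxt i)" by (rule G(4))
  \<comment> \<open>Here length at least 3 enters: in a closed walk of length 2 both neighbours
    occupy the same position.\<close>
  moreover have "prv i \<noteq> nxt i" using i k by (auto simp: prv_def nxt_def)
  ultimately show False
    using u(2) np(1)[OF i(1)] n(1)[OF i(1)] unfolding verts by (auto simp: distinct_conv_nth)
qed

text \<open>Induction on the last arc of the walk, between \<open>y\<close> and \<open>x\<close>. If
  it goes down, an ancestor of \<open>x\<close> other than \<open>x\<close> is an ancestor of
  \<open>y\<close> because parents are unique. If it goes up, every ancestor of \<open>x\<close> is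
  one of \<open>y\<close>.\<close>

lemma ancestor_in_walk:
  assumes "arborescence_from G r"
    and "pre_digraph.awalk (with_proj (mk_symmetric (with_proj G))) r p x" "(a, x) \<in> (parcs G)\<^sup>*"
  shows "a \<in> set (pawalk_verts r p)"
  using assms(2,3)
proof (induction p arbitrary: x a rule: rev_induct)
  note G = arborescence_fromD[OF assms(1)]
  interpret pair_fin_digraph G by (rule G)
  let ?S = "mk_symmetric (with_proj G)"
  interpret S: pair_wf_digraph ?S by (rule wellformed_mk_symmetric)
  {
    case Nil
    then have "(a, r) \<in> (parcs G)\<^sup>*" by (simp add: S.awalk_Nil_iff)
    then show ?case using G(5) by (auto elim: rtranclE)
  next
    case (snoc e p)
    obtain y where e: "e = (y, x)" and y: "S.awalk r p y" "(y, x) \<in> parcs ?S"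
      using snoc.prems(1) by (cases e) (auto simp: S.awalk_simps)
    have verts: "set (pawalk_verts r (p @ [e])) = insert x (set (pawalk_verts r p))"
      using S.awalk_verts_append[OF snoc.prems(1)] by (simp add: e)
    consider "(y, x) \<in> parcs G" | "(x, y) \<in> parcs G"
      using y(2) by (auto simp: parcs_mk_symmetric_iff)
    then show ?case
    proof cases
      case 1
      from snoc.prems(2) show ?thesis
      proof (cases rule: rtranclE)
        case (step z)
        with 1 G(4) have "(a, y) \<in> (parcs G)\<^sup>*" by metis
        then show ?thesis using snoc.IH[OF y(1)] verts by simp
      qed (simp add: verts)
    next
      case 2
      then have "(a, y) \<in> (parcs G)\<^sup>*" using snoc.prems(2) by auto
      then show ?thesis using snoc.IH[OF y(1)] verts by simp
    qed
  }
qed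

section \<open>Oriented trees are arborescences\<close>

text \<open>Any two vertices are joined through the root, and a parent, being an ancestor, lies on
  every walk from the root to its child.\<close>

lemma arborescence_imp_oriented_tree:
  assumes "arborescence_from G r"
  shows "oriented_tree G" "oriented_away_from G r"
proof -
  note G = arborescence_fromD[OF assms]
  interpret pair_fin_digraph G by (rule G)
  let ?S = "mk_symmetric (with_proj G)"
  interpret S: pair_wf_digraph ?S by (rule wellformed_mk_symmetric)
  have "asym (parcs G)"
    using acyclic_arborescence[OF assms] by (intro asymI) (meson acyclic_def r_into_trancl' trancl_into_trancl)
  moreover have "connected (with_proj G)"
  proof -
    have root: "r \<rightarrow>\<^sup>*\<^bsub>with_proj ?S\<^esub> v" if "v \<in> pverts G" for v
      using G(3)[OF that]
    proof (induction rule: rtrancl_induct)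
      case base
      then show ?case using G(2) by simp
    next
      case (step u v)
      then have "(u, v) \<in> parcs ?S" by (simp add: parcs_mk_symmetric_iff)
      then show ?case using step.IH S.reachable_adj_trans by auto
    qed
    have "u \<rightarrow>\<^sup>*\<^bsub>with_proj ?S\<^esub> v" if "u \<in> pverts G" "v \<in> pverts G" for u v
      using root[OF that(2)] symmetric_reachable[OF symmetric_mk_symmetric root[OF that(1)]]
      by (rule S.reachable_trans[rotated])
    then show ?thesis using G(2) by (auto simp: connected_def strongly_connected_def)
  qed
  ultimately show "oriented_tree G"
    unfolding oriented_tree_def using G(1) no_cycle_arborescence[OF assms] by (auto simp: not_le)
  have "u \<in> set (pawalk_verts r p)" if "(u, v) \<in> parcs G" "S.apath r p v" for u v p
    using ancestor_in_walk[OF assms, of p v u] that by (auto simp: S.apath_def)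
  then show "oriented_away_from G r"
    unfolding oriented_away_from_def using G(2) by (auto simp: awalk_verts_with_proj_eq)
qed

text \<open>Undirected paths from \<open>r\<close> turn out to be directed, which gives
  reachability; a second parent of a vertex would close an undirected cycle.\<close>

lemma oriented_tree_imp_arborescence:
  assumes "oriented_tree G" "oriented_away_from G r"
  shows "arborescence_from G r"
proof -
  have fin: "pair_fin_digraph G" and as: "asym (parcs G)" and conn: "connected (with_proj G)"
    and nocyc: "\<And>p. pre_digraph.cycle (with_proj (mk_symmetric (with_proj G))) p \<Longrightarrow> length p < 3"
    using assms(1) unfolding oriented_tree_def by (auto simp: not_le)
  interpret pair_fin_digraph G by (rule fin)
  let ?S = "mk_symmetric (with_proj G)"
  interpret S: pair_wf_digraph ?S by (rule wellformed_mk_symmetric)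
  have r: "r \<in> pverts G" and away: "\<And>u v p. (u, v) \<in> parcs G \<Longrightarrow> S.apath r p v \<Longrightarrow>
      u \<in> set (pawalk_verts r p)"
    using assms(2) unfolding oriented_away_from_def by (auto simp: awalk_verts_with_proj_eq)
  \<comment> \<open>Were the last arc oriented as \<open>(v, u)\<close>, then \<open>v\<close> would
    lie on the path \<open>q\<close> to \<open>u\<close>, contrary to the distinctness of the
    vertices.\<close>
  have last_arc: "(u, v) \<in> parcs G" "S.apath r q u" if "S.apath r (q @ [(u, v)]) v" for q u v
  proof -
    show q: "S.apath r q u"
      using that by (auto simp: S.apath_append_iff S.apath_simps)
    have uv: "(u, v) \<in> parcs ?S" "v \<notin> set (pawalk_verts r q)"
      using that by (auto simp: S.apath_append_iff S.apath_simps)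
    then show "(u, v) \<in> parcs G" using away[OF _ q, of v] by (auto simp: parcs_mk_symmetric_iff)
  qed
  have path: "\<exists>p. S.apath r p v" if "v \<in> pverts G" for v
    using conn r that unfolding connected_def strongly_connected_def
    by (auto simp flip: S.reachable_apath)
  have reach: "(r, v) \<in> (parcs G)\<^sup>*" if "S.apath r p v" for p v
    using that
  proof (induction p arbitrary: v rule: rev_induct)
    case Nil
    then show ?case by (simp add: S.apath_simps)
  next
    case (snoc e p)
    obtain u where e: "e = (u, v)"
      using snoc.prems by (cases e) (auto simp: S.apath_append_iff S.apath_simps)
    have "S.apath r (p @ [(u, v)]) v" using snoc.prems by (simp add: e)
    from snoc.IH[OF last_arc(2)[OF this]] last_arc(1)[OF this] show ?case
      by (rule rtrancl_into_rtrancl)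
  qed
  have noroot: "(u, r) \<notin> parcs G" for u
  proof
    assume *: "(u, r) \<in> parcs G"
    then have "u = r" using away[OF *, of "[]"] r by (auto simp: S.apath_simps)
    then show False using * as by (auto simp: asym_iff)
  qed
  have uniq: "u = u'" if uv: "(u, v) \<in> parcs G" "(u', v) \<in> parcs G" for u u' v
  proof -
    \<comment> \<open>A second parent \<open>u2\<close> lies on the path to \<open>v\<close> that
      ends with the arc from \<open>u1\<close>. The piece \<open>s\<close> from \<open>u2\<close> to
      \<open>v\<close> has at least two arcs as \<open>u1 \<noteq> u2\<close>, so together with the
      arc back to \<open>u2\<close> it is a cycle of length at least 3.\<close>
    have "u1 = u2" if p: "S.apath r (q @ [(u1, v)]) v" and u2: "(u2, v) \<in> parcs G" for q u1 u2
    proof (rule ccontr)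
      assume ne: "u1 \<noteq> u2"
      let ?p = "q @ [(u1, v)]"
      have aw: "S.awalk r ?p v" using p by (simp add: S.apath_def)
      obtain q' s where s: "?p = q' @ s" "S.awalk r q' u2" "S.awalk u2 s v"
        using S.awalk_decomp[OF aw away[OF u2 p]] by blast
      have "S.apath u2 s v"
        using p[unfolded s(1)] S.awlast_of_awalk[OF s(2)] by (simp add: S.apath_append_iff)
      have "u2 \<noteq> v" using u2 as by (auto simp: asym_iff)
      then have "s \<noteq> []" using s(3) by (auto simp: S.awalk_simps)
      then obtain s' where s': "s = s' @ [(u1, v)]"
        using s(1) by (cases s rule: rev_cases) auto
      have "s' \<noteq> []" using s(3) ne by (auto simp: s' S.awalk_simps)
      have vu: "(v, u2) \<in> parcs ?S" using u2 by (simp add: parcs_mk_symmetric_iff)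
      have cyc: "S.awalk u2 (s @ [(v, u2)]) u2"
        using s(3) vu by (auto simp: S.awalk_simps)
      have vs: "pawalk_verts u2 (s @ [(v, u2)]) = pawalk_verts u2 s @ [u2]"
        using S.awalk_verts_append[OF cyc] by simp
      have "distinct (tl (pawalk_verts u2 s) @ [u2])"
        using \<open>S.apath u2 s v\<close> \<open>s \<noteq> []\<close> s(3) by (cases s) (auto simp: S.apath_simps S.apath_def)
      moreover have "tl (pawalk_verts u2 (s @ [(v, u2)])) = tl (pawalk_verts u2 s) @ [u2]"
        using vs by (metis S.awalk_verts_non_Nil tl_append2)
      ultimately have "S.cycle (s @ [(v, u2)])" using cyc by (auto simp: S.cycle_def)
      from nocyc[OF this] show False using s' \<open>s' \<noteq> []\<close> by (cases s') auto
    qed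
    note last_parent = this
    obtain p where p: "S.apath r p v" using path[of v] in_arcsD2[OF uv(1)] by blast
    have "p \<noteq> []" using p uv(1) noroot by (auto simp: S.apath_simps)
    then obtain e q where q: "p = q @ [e]" by (cases p rule: rev_cases) auto
    then obtain w where "e = (w, v)"
      using p by (cases e) (auto simp: S.apath_append_iff S.apath_simps)
    then have "w = u" "w = u'" using last_parent[of q w] p q uv by auto
    then show ?thesis by simp
  qed
  show ?thesis unfolding arborescence_from_def using fin r reach path uniq noroot by blast
qed

section \<open>Decreasing trees as parent maps\<close>

definition parent_graph :: "nat \<Rightarrow> (nat \<Rightarrow> nat) \<Rightarrow> nat pair_pre_digraph" where
  "parent_graph n f = \<lparr>pverts = {1..n}, parcs = {(f v, v) |v. v \<in> {1..<n}}\<rparr>"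

text \<open>Each non-root vertex has exactly one incoming arc, so the edge signs can be stored as a
  set of vertices.\<close>

definition sign_labeling :: "nat set \<Rightarrow> nat pair_pre_digraph \<Rightarrow> nat \<times> nat \<Rightarrow> sign" where
  "sign_labeling P G = (\<lambda>e\<in>parcs G. if snd e \<in> P then Plus else Minus)"

lemma parent_graph_simps:
  "pverts (parent_graph n f) = {1..n}"
  "(u, v) \<in> parcs (parent_graph n f) \<longleftrightarrow> v \<in> {1..<n} \<and> u = f v"
  by (auto simp: parent_graph_def)

lemma signed_arc_parent_graph:
  assumes "P \<subseteq> {1..<n}"
  shows "signed_arc (parent_graph n f) (sign_labeling P (parent_graph n f)) Plus u v \<longleftrightarrow>
      v \<in> P \<and> u = f v"
    and "signed_arc (parent_graph n f) (sign_labeling P (parent_graph n f)) Minus u v \<longleftrightarrow>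
      v \<in> {1..<n} - P \<and> u = f v"
  using assms by (auto simp: signed_arc_def sign_labeling_def parent_graph_simps)

section \<open>From parent maps to decreasing trees\<close>

text \<open>The rank \<open>\<phi>\<close> increases towards the root: on the plus part \<open>v + f v\<close> increases because
  every vertex is smaller than its grandparent.\<close>

lemma arborescence_parent_graph:
  assumes "n \<ge> 1" "P \<subseteq> {1..<n}" "f \<in> parent_maps n {1..<n} P"
  shows "arborescence_from (parent_graph n f) n"
proof -
  let ?G = "parent_graph n f"
  have f: "f v \<in> {1..n}" if "v \<in> {1..<n}" for v
  proof -
    have "f v \<in> insert n {1..<n}" using assms(3) that unfolding parent_maps_def by blast
    then show ?thesis using assms(1) by auto
  qed
  have minus: "v < f v" if "v \<in> {1..<n} - P" for v
    using assms(3) that unfolding parent_maps_def by blast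
  have plus: "f v = n \<or> f v \<in> P \<and> v < f (f v)" if "v \<in> P" for v
    using assms(3) that unfolding parent_maps_def by blast
  \<comment> \<open>Minus vertices have rank below \<open>n\<close>, plus vertices above
    \<open>n\<close> but below \<open>3 * n\<close>, and the root has rank \<open>3 * n\<close>. The
    summand \<open>n\<close> makes the step from a minus to a plus vertex increasing.\<close>
  define \<phi> where "\<phi> v = (if v = n then 3 * n else if v \<in> P then n + v + f v else v)" for v
  have le: "\<phi> v \<le> 3 * n" if "v \<in> {1..n}" for v
    using f[of v] that by (auto simp: \<phi>_def)
  have \<phi>_less: "\<phi> v < \<phi> (f v)" if v: "v \<in> {1..<n}" for v
  proof (cases "v \<in> P")
    case True
    then show ?thesis using plus[OF True] f[OF v] v assms(2) by (auto simp: \<phi>_def)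
  next
    case False
    then show ?thesis using minus[of v] f[OF v] v by (auto simp: \<phi>_def)
  qed
  have "(n, v) \<in> (parcs ?G)\<^sup>*" if "v \<in> {1..n}" for v
    using that
  proof (induction v rule: measure_induct_rule[of "\<lambda>v. 3 * n - \<phi> v"])
    case (less v)
    show ?case
    proof (cases "v = n")
      case False
      then have v: "v \<in> {1..<n}" using less.prems by auto
      have "3 * n - \<phi> (f v) < 3 * n - \<phi> v"
        using \<phi>_less[OF v] le[OF f[OF v]] by linarith
      then have "(n, f v) \<in> (parcs ?G)\<^sup>*" using less.IH f[OF v] by blast
      moreover have "(f v, v) \<in> parcs ?G" using v by (simp add: parent_graph_simps)
      ultimately show ?thesis by (rule rtrancl_into_rtrancl)
    qed simp
  qed
  moreover have "pair_fin_digraph ?G"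
  proof
    have "parcs ?G = (\<lambda>v. (f v, v)) ` {1..<n}" by (auto simp: parent_graph_def)
    then show "finite (parcs ?G)" by simp
  qed (use f in \<open>auto simp: parent_graph_def\<close>)
  ultimately show ?thesis
    using assms(1) by (auto simp: arborescence_from_def parent_graph_simps)
qed

text \<open>A plus path \<open>a, b, c, d\<close> has \<open>d < b\<close>, whereas in each of the
  six forbidden patterns the fourth entry exceeds the second.\<close>

lemma decreasing_pm_tree_parent_graph:
  assumes "n \<ge> 1" "P \<subseteq> {1..<n}" "f \<in> parent_maps n {1..<n} P"
  shows "decreasing_pm_tree n (parent_graph n f) (sign_labeling P (parent_graph n f))"
proof -
  note sa = signed_arc_parent_graph[OF assms(2), of f]
  have minus: "v < f v" if "v \<in> {1..<n} - P" for v
    using assms(3) that unfolding parent_maps_def by blast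
  have plus: "f v = n \<or> f v \<in> P \<and> v < f (f v)" if "v \<in> P" for v
    using assms(3) that unfolding parent_maps_def by blast
  have nP: "n \<notin> P" using assms(2) by auto
  have path: "c < a \<and> d < b" if "plus_path (parent_graph n f) (sign_labeling P (parent_graph n f)) [a, b, c, d]"
    for a b c d
    using that plus[of c] plus[of d] nP by (auto simp: plus_path_def sa)
  have "sign_labeling P (parent_graph n f) \<in> parcs (parent_graph n f) \<rightarrow>\<^sub>E {Plus, Minus}"
    by (auto simp: sign_labeling_def)
  then have "pm_tree n (parent_graph n f) (sign_labeling P (parent_graph n f))"
    using arborescence_imp_oriented_tree[OF arborescence_parent_graph[OF assms]]
    by (simp add: pm_tree_def parent_graph_simps)
  moreover have "\<forall>vs\<in>{[i4, i1, i2, i3], [i4, i1, i3, i2], [i4, i2, i1, i3]}.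
        \<not> plus_path (parent_graph n f) (sign_labeling P (parent_graph n f)) vs \<and>
        \<not> plus_path (parent_graph n f) (sign_labeling P (parent_graph n f)) (rev vs)"
    if "i1 < i2 \<and> i2 < i3 \<and> i3 < i4" for i1 i2 i3 i4
    using that path by fastforce
  moreover have "\<not> (signed_arc (parent_graph n f) (sign_labeling P (parent_graph n f)) Minus j i \<and>
      signed_arc (parent_graph n f) (sign_labeling P (parent_graph n f)) Plus i k)" for i j k
    using plus[of k] by (auto simp: sa)
  ultimately show ?thesis
    unfolding decreasing_pm_tree_def using minus by (simp add: sa)
qed

section \<open>From decreasing trees to parent maps\<close>

text \<open>For a directed path \<open>x, w, u, v\<close> with \<open>u < x\<close> and \<open>w < v\<close>, the maximum is \<open>x\<close> or \<open>v\<close>,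
  and each of the six possible orderings is a forbidden pattern.  Hence by induction from the root,
  where \<open>u < x\<close> holds since the root is maximal, every plus vertex is smaller than its grandparent.\<close>

lemma decreasing_pm_tree_imp_parent_map:
  assumes "decreasing_pm_tree n G l"
  obtains P f where "P \<subseteq> {1..<n}" "f \<in> parent_maps n {1..<n} P"
    "G = parent_graph n f" "l = sign_labeling P (parent_graph n f)"
proof -
  have dec: "pm_tree n G l" "\<forall>u v. signed_arc G l Minus u v \<longrightarrow> v < u"
    "\<forall>i j k. i < j \<longrightarrow> \<not> (signed_arc G l Minus j i \<and> signed_arc G l Plus i k)"
    "\<forall>i1 i2 i3 i4. i1 < i2 \<and> i2 < i3 \<and> i3 < i4 \<longrightarrow>
        (\<forall>vs \<in> {[i4, i1, i2, i3], [i4, i1, i3, i2], [i4, i2, i1, i3]}.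
           \<not> plus_path G l vs \<and> \<not> plus_path G l (rev vs))"
    using assms unfolding decreasing_pm_tree_def by simp_all
  have G: "arborescence_from G n" and verts: "pverts G = {1..n}"
    and l: "l \<in> parcs G \<rightarrow>\<^sub>E {Plus, Minus}"
    using dec(1) oriented_tree_imp_arborescence[of G n] unfolding pm_tree_def by simp_all
  have pattern: "\<not> plus_path G l vs \<and> \<not> plus_path G l (rev vs)"
    if "i1 < i2" "i2 < i3" "i3 < i4" "vs \<in> {[i4, i1, i2, i3], [i4, i1, i3, i2], [i4, i2, i1, i3]}"
    for i1 i2 i3 i4 vs
    using dec(4)[rule_format, of i1 i2 i3 i4 vs] that by simp
  note GD = arborescence_fromD[OF G]
  interpret pair_fin_digraph G by (rule GD(1))
  have acyc: "(x, x) \<notin> (parcs G)\<^sup>+" for x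
    using acyclic_arborescence[OF G] by (auto simp: acyclic_def)
  define f where "f = (\<lambda>v\<in>{1..<n}. THE u. (u, v) \<in> parcs G)"
  have ex: "\<exists>u. (u, v) \<in> parcs G" if "v \<in> {1..<n}" for v
    using GD(3)[of v] that verts by (auto elim: rtranclE)
  have arc: "(u, v) \<in> parcs G \<longleftrightarrow> v \<in> {1..<n} \<and> u = f v" for u v
  proof -
    have "v \<in> {1..<n}" if "(u, v) \<in> parcs G" for u
      using in_arcsD2[OF that] verts GD(5) that by (cases "v = n") auto
    moreover have "(THE u. (u, v) \<in> parcs G) = u" if "(u, v) \<in> parcs G" for u
      using that GD(4) by blast
    ultimately show ?thesis using ex[of v] by (auto simp: f_def)
  qed
  have fv: "f v \<in> {1..n}" if "v \<in> {1..<n}" for v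
    using arc[of "f v" v] that in_arcsD1 verts by blast
  define P where "P = {v \<in> {1..<n}. l (f v, v) = Plus}"
  have P: "P \<subseteq> {1..<n}" by (auto simp: P_def)
  have plus_arc: "signed_arc G l Plus u v \<longleftrightarrow> v \<in> P \<and> u = f v" for u v
    by (auto simp: signed_arc_def arc P_def)
  have minus_arc: "signed_arc G l Minus u v \<longleftrightarrow> v \<in> {1..<n} - P \<and> u = f v" for u v
    by (auto simp: signed_arc_def arc P_def) (metis sign.exhaust)
  have GP: "G = parent_graph n f"
    using verts arc by (intro pair_pre_digraph.equality) (auto simp: parent_graph_def)
  have "l e = sign_labeling P G e" for e
  proof (cases "e \<in> parcs G")
    case True
    then show ?thesis
      using arc[of "fst e" "snd e"] sign.exhaust[of "l e"]
      by (cases e) (auto simp: sign_labeling_def P_def)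
  next
    case False
    then show ?thesis using PiE_arb[OF l] by (simp add: sign_labeling_def)
  qed
  then have lP: "l = sign_labeling P (parent_graph n f)" using GP by auto
  \<comment> \<open>If \<open>f v\<close> were a minus vertex, then \<open>f v < f (f v)\<close>,
    and the path from \<open>f (f v)\<close> through \<open>f v\<close> to \<open>v\<close> would be
    a minus edge followed by a plus edge.\<close>
  have plus_parent: "f v = n \<or> f v \<in> P" if "v \<in> P" for v
  proof (rule ccontr)
    assume "\<not> ?thesis"
    then have "f v \<in> {1..<n} - P" using fv[of v] that P by auto
    then have "signed_arc G l Minus (f (f v)) (f v)" by (simp add: minus_arc)
    moreover have "signed_arc G l Plus (f v) v" using that by (simp add: plus_arc)
    ultimately show False using dec(2,3) by blast
  qed
  have grandparent: "v \<in> P \<longrightarrow> f v = n \<or> v < f (f v)" if "(n, v) \<in> (parcs G)\<^sup>*" for v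
    using that
  proof (induction rule: rtrancl_induct)
    case base
    then show ?case using P by auto
  next
    case (step u v)
    then have uv: "u = f v" and v: "v \<in> {1..<n}" using arc by auto
    show ?case
    proof (intro impI, rule ccontr)
      assume vP: "v \<in> P" and "\<not> (f v = n \<or> v < f (f v))"
      then have un: "u \<noteq> n" and le: "f u \<le> v" using uv by auto
      define w where "w = f u"
      define x where "x = f w"
      have uP: "u \<in> P" using plus_parent[OF vP] un uv by simp
      \<comment> \<open>The root is larger than \<open>v\<close>, so \<open>w \<le> v\<close> keeps
        \<open>w\<close> away from it. Hence \<open>u\<close> has a grandparent \<open>x\<close>,
        and the induction hypothesis for \<open>u\<close> gives \<open>u < x\<close>.\<close>
      have "w \<noteq> n" using le v by (auto simp: w_def)
      then have wP: "w \<in> P" and xu: "u < x"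
        using plus_parent[OF uP] step.IH uP by (auto simp: w_def x_def)
      have arcs: "(x, w) \<in> parcs G" "(w, u) \<in> parcs G" "(u, v) \<in> parcs G"
        using arc vP uP wP P uv by (auto simp: w_def x_def)
      have path: "plus_path G l [x, w, u, v]"
        using vP uP wP uv by (simp add: plus_path_def plus_arc w_def x_def)
      have ne: "w \<noteq> v" "u \<noteq> v" "w \<noteq> u" "x \<noteq> w" "x \<noteq> v"
        using arcs acyc by (meson trancl.r_into_trancl trancl_into_trancl)+
      have wv: "w < v" using le ne(1) by (simp add: w_def)
      show False
      proof (cases "v < x")
        case True
        then consider "w < u" "u < v" | "w < v" "v < u" | "u < w" "w < v"
          using wv ne by linarith
        then show False
        proof cases
          case 1
          then show False using pattern[of w u v x "[x, w, u, v]"] path True by auto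
        next
          case 2
          then show False using pattern[of w v u x "[x, w, u, v]"] path xu by auto
        next
          case 3
          then show False using pattern[of u w v x "[x, w, u, v]"] path True by auto
        qed
      next
        case False
        then have "x < v" using ne by simp
        consider "w < u" "u < x" | "u < w" "w < x" | "u < x" "x < w"
          using xu ne by linarith
        then show False
        proof cases
          case 1
          then show False using pattern[of w u x v "[v, u, w, x]"] path \<open>x < v\<close> by auto
        next
          case 2
          then show False using pattern[of u w x v "[v, u, w, x]"] path \<open>x < v\<close> by auto
        next
          case 3
          then show False using pattern[of u x w v "[v, u, w, x]"] path wv by auto
        qed
      qed
    qed
  qed
  have "f \<in> parent_maps n {1..<n} P"
    unfolding parent_maps_def
  proof (intro CollectI conjI ballI)
    show "f \<in> {1..<n} \<rightarrow>\<^sub>E insert n {1..<n}"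
    proof (rule PiE_I)
      fix v assume "v \<in> {1..<n}"
      then show "f v \<in> insert n {1..<n}" using fv[of v] by auto
    qed (auto simp: f_def restrict_def)
    show "v < f v" if "v \<in> {1..<n} - P" for v
      using dec(2) minus_arc that by blast
    show "f v = n \<or> f v \<in> P \<and> v < f (f v)" if "v \<in> P" for v
    proof -
      have "v \<in> pverts G" using that P verts by auto
      then show ?thesis using plus_parent[OF that] grandparent[OF GD(3)] that by blast
    qed
  qed
  with P show ?thesis using GP lP by (rule that)
qed

section \<open>The bijection and the count\<close>

theorem theorem10p1:
  fixes n :: nat
  assumes "n \<ge> 1"
  shows "card {(G, l). decreasing_pm_tree n G l} = 2 ^ (n - 1) * fact (n - 1)"
proof -
  let ?E = "SIGMA P:Pow {1..<n}. parent_maps n {1..<n} P"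
  let ?T = "\<lambda>(P, f). (parent_graph n f, sign_labeling P (parent_graph n f))"
  \<comment> \<open>The arcs recover \<open>f\<close> on the non-root vertices, extensionality
    recovers the rest, and the plus arcs recover \<open>P\<close>.\<close>
  have "inj_on ?T ?E"
  proof (rule inj_onI)
    fix x y assume "x \<in> ?E" "y \<in> ?E" and eq: "?T x = ?T y"
    then obtain P f Q g where x: "x = (P, f)" "P \<subseteq> {1..<n}" "f \<in> parent_maps n {1..<n} P"
      and y: "y = (Q, g)" "Q \<subseteq> {1..<n}" "g \<in> parent_maps n {1..<n} Q" by auto
    have G: "parent_graph n f = parent_graph n g"
      and L: "sign_labeling P (parent_graph n f) = sign_labeling Q (parent_graph n f)"
      using eq x y by auto
    have "f v = g v" if "v \<in> {1..<n}" for v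
      using that parent_graph_simps(2)[of "f v" v n f] parent_graph_simps(2)[of "f v" v n g] G by simp
    moreover have "f \<in> extensional {1..<n}" "g \<in> extensional {1..<n}"
      using x y by (auto simp: parent_maps_def PiE_def)
    ultimately have "f = g" by (intro extensionalityI) auto
    moreover have "v \<in> P \<longleftrightarrow> v \<in> Q" for v
      using signed_arc_parent_graph(1)[OF x(2), of f "f v" v]
        signed_arc_parent_graph(1)[OF y(2), of f "f v" v] L by simp
    ultimately show "x = y" using x y by auto
  qed
  moreover have "?T ` ?E = {(G, l). decreasing_pm_tree n G l}"
  proof (intro equalityI subsetI)
    fix x assume "x \<in> ?T ` ?E"
    then show "x \<in> {(G, l). decreasing_pm_tree n G l}"
      using decreasing_pm_tree_parent_graph[OF assms] by auto
  next
    fix x assume "x \<in> {(G, l). decreasing_pm_tree n G l}"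
    then obtain G l where x: "x = (G, l)" and "decreasing_pm_tree n G l" by auto
    from this(2) obtain P f where "(P, f) \<in> ?E" "G = parent_graph n f"
      "l = sign_labeling P (parent_graph n f)"
      by (rule decreasing_pm_tree_imp_parent_map) auto
    then show "x \<in> ?T ` ?E" unfolding x by (intro image_eqI[of _ _ "(P, f)"]) auto
  qed
  ultimately have "card {(G, l). decreasing_pm_tree n G l} = card ?E"
    using card_image[of ?T ?E] by simp
  then show ?thesis using card_signed_parent_maps[of "{1..<n}" n] by simp
qed

end
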